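(* Let $\nu$ be a positive integer and, for $k=1,\dots,\nu$, let $N_k=n_k+n_{k+1}+\dots+n_\nu$. Then for $|q|<1$, \[ \sum_{n_1,\dots,n_\nu\geq 0} \frac{q^{3(N_1^2+N_2^2+\dots+N_\nu^2)} (-q;q^2)_{3n_\nu}}{(q^6;q^6)_{n_1}(q^6;q^6)_{n_2}\cdots (q^6;q^6)_{n_{\nu-1}}(q^6;q^6)_{2n_\nu}} = \frac{(-q^3;q^3)_\infty}{(q^{12};q^{12})_\infty}\,\bigl(q^{6(\nu+1)},-q^{3\nu+1},-q^{3\nu+5};q^{6(\nu+1)}\bigr)_\infty. \]
   Context: For $n\ge 0$, $(a;q)_n=\prod_{k=0}^{n-1}(1-aq^k)$, $(a;q)_\infty=\prod_{k\ge0}(1-aq^k)$, and $(a_1,\dots,a_r;q)_\infty=(a_1;q)_\infty\cdots(a_r;q)_\infty$. When $\nu=1$ the denominator is just $(q^6;q^6)_{2n_1}$. *)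

theory Defs
  imports "HOL-Analysis.Analysis"
begin

definition qpoch :: "complex \<Rightarrow> complex \<Rightarrow> nat \<Rightarrow> complex" where
  "qpoch a q n = (\<Prod>k<n. 1 - a * q ^ k)"

text \<open>The infinite product converges whenever \<open>norm q < 1\<close>. Outside that range the value may be
  unspecified, because \<^const>\<open>prodinf\<close> is.\<close>

definition qpoch_inf :: "complex \<Rightarrow> complex \<Rightarrow> complex" where
  "qpoch_inf a q = (\<Prod>k. 1 - a * q ^ k)"

definition qpoch_inf_list :: "complex list \<Rightarrow> complex \<Rightarrow> complex" where
  "qpoch_inf_list as q = prod_list (map (\<lambda>a. qpoch_inf a q) as)"

definition tail_sum :: "nat \<Rightarrow> (nat \<Rightarrow> nat) \<Rightarrow> nat \<Rightarrow> nat" where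
  "tail_sum \<nu> n k = (\<Sum>i=k..\<nu>. n i)"

end

theory Submission
  imports Defs
begin

text \<open>
  Put \<open>h = q\<^sup>3\<close>, \<open>p = h\<^sup>2\<close> and \<open>z = q\<^sup>2\<close>. Since \<open>(-q;q\<^sup>2)\<^sub>3\<^sub>n = (-h;p)\<^sub>n (-zh;p)\<^sub>n (-h/z;p)\<^sub>n\<close>, the finite
  Jacobi triple product writes the innermost factor \<open>(-q;q\<^sup>2)\<^sub>3\<^sub>n / (p;p)\<^sub>2\<^sub>n\<close> as
  \<open>(-h;p)\<^sub>n \<Sum>\<^sub>r h^(r^2) z^r / ((p;p)\<^sub>n\<^sub>-\<^sub>r (p;p)\<^sub>n\<^sub>+\<^sub>r)\<close>. By the q-Chu-Vandermonde sum, each summation over one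
  of the \<open>n\<^sub>k\<close> preserves this shape and multiplies the coefficient of index \<open>r\<close> by \<open>h^(r^2)\<close> (the
  Bailey chain for \<open>a = 1\<close>). The last summation is unrestricted and is obtained as a limit by
  Tannery's theorem; it leaves \<open>\<Sum>\<^sub>r h^((\<nu>+1) r^2) z^r\<close>, a product by the Jacobi triple product.
\<close>

section \<open>Finite and infinite q-shifted factorials\<close>

lemma qpoch_0 [simp]: "qpoch a q 0 = 1"
  by (simp add: qpoch_def)

lemma qpoch_Suc: "qpoch a q (Suc n) = qpoch a q n * (1 - a * q ^ n)"
  by (simp add: qpoch_def)

lemma qpoch_add: "qpoch a q (m + n) = qpoch a q m * qpoch (a * q ^ m) q n"
  by (induction n) (simp_all add: qpoch_Suc power_add mult.assoc)

lemma qpoch_Suc_shift: "qpoch a q (Suc n) = (1 - a) * qpoch (a * q) q n"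
  using qpoch_add[of a q 1 n] by (simp add: qpoch_Suc)

lemma qpoch_eq_0_iff: "qpoch a q n = 0 \<longleftrightarrow> (\<exists>k<n. a * q ^ k = 1)"
  by (auto simp: qpoch_def)

lemma mult_power_neq_1:
  fixes a q :: complex
  assumes "norm a < 1" "norm q < 1"
  shows "a * q ^ k \<noteq> 1"
proof -
  have "norm (a * q ^ k) = norm a * norm q ^ k"
    by (simp add: norm_mult norm_power)
  also have "\<dots> \<le> norm a * 1"
    using assms by (intro mult_left_mono power_le_one) auto
  finally show ?thesis
    using assms(1) by auto
qed

lemma qpoch_nonzero: "norm q < 1 \<Longrightarrow> qpoch q q n \<noteq> 0"
  using mult_power_neq_1[of q q] by (auto simp: qpoch_eq_0_iff)

lemma convergent_prod_qpoch:
  fixes a q :: complex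
  assumes "norm q < 1"
  shows "convergent_prod (\<lambda>k. 1 - a * q ^ k)"
proof (intro abs_convergent_prod_imp_convergent_prod summable_imp_abs_convergent_prod)
  show "summable (\<lambda>k. norm (1 - a * q ^ k - 1))"
    using assms by (auto simp: norm_mult norm_power intro!: summable_mult summable_geometric)
qed

lemma qpoch_LIMSEQ:
  assumes "norm q < 1"
  shows "qpoch a q \<longlonglongrightarrow> qpoch_inf a q"
  using convergent_prod_LIMSEQ[OF convergent_prod_qpoch[OF assms, of a]]
  unfolding LIMSEQ_lessThan_iff_atMost[symmetric] qpoch_inf_def qpoch_def .

lemma qpoch_inf_nonzero: "norm q < 1 \<Longrightarrow> qpoch_inf q q \<noteq> 0"
  unfolding qpoch_inf_def
  using mult_power_neq_1[of q q] by (intro prodinf_nonzero convergent_prod_qpoch) auto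

lemma qpoch_LIMSEQ_comp:
  assumes "norm q < 1" "filterlim g at_top sequentially"
  shows "(\<lambda>n. qpoch a q (g n)) \<longlonglongrightarrow> qpoch_inf a q"
  using filterlim_compose[OF qpoch_LIMSEQ[OF assms(1)] assms(2)] .

text \<open>The reciprocals converge because the infinite product does not vanish. The bound is the
  uniform majorant in every later application of Tannery's theorem and in the summability of the
  multiple sum.\<close>

lemma inverse_qpoch_bounded:
  assumes "norm q < 1"
  obtains K where "K > 0" "\<And>n. norm (inverse (qpoch q q n)) \<le> K"
proof -
  have "(\<lambda>n. inverse (qpoch q q n)) \<longlonglongrightarrow> inverse (qpoch_inf q q)"
    using assms by (intro tendsto_inverse qpoch_LIMSEQ qpoch_inf_nonzero)
  then have "Bseq (\<lambda>n. inverse (qpoch q q n))"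
    by (intro convergent_imp_Bseq convergentI)
  then show ?thesis
    using that by (auto simp: Bseq_def)
qed

section \<open>Finite q-summations\<close>

text \<open>The \<open>q\<close>-Pascal rule, applied to the left factor, lowers \<open>M\<close> and shifts \<open>a\<close> to \<open>a p\<close>.\<close>

lemma q_Chu_Vandermonde:
  fixes p :: complex
  assumes "norm p < 1"
  shows "(\<Sum>k\<le>M. qpoch a p k * (- b) ^ k * p ^ (k choose 2) * qpoch (a * b * p ^ k) p (M - k)
            / (qpoch p p k * qpoch p p (M - k))) = qpoch b p M / qpoch p p M"
proof (induction M arbitrary: a)
  case 0
  then show ?case by (simp add: binomial_eq_0)
next
  case (Suc M)
  note nz = qpoch_nonzero[OF assms]
  define t where "t = (\<lambda>a M k. qpoch a p k * (- b) ^ k * p ^ (k choose 2)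
    * qpoch (a * b * p ^ k) p (M - k) / (qpoch p p k * qpoch p p (M - k)))"
  have IH: "(\<Sum>k\<le>M. t a M k) = qpoch b p M / qpoch p p M" for a
    using Suc.IH by (simp add: t_def)
  have pnz: "1 - p ^ Suc n \<noteq> 0" for n
    using mult_power_neq_1[of p p n] assms by auto
  \<comment> \<open>Here \<open>1 - p ^ (Suc M - k)\<close> cancels the last factor of
    \<open>(p;p)\<close> of length \<open>Suc M - k\<close>; in \<open>B\<close>,
    \<open>1 - p ^ Suc k\<close> cancels that of the other denominator. Both leave summands for
    \<open>M\<close>.\<close>
  have A: "(1 - p ^ (Suc M - k)) * t a (Suc M) k = (1 - a * b * p ^ M) * t a M k" if "k \<le> M" for k
  proof -
    have *: "Suc M - k = Suc (M - k)" "p ^ M = p ^ k * p ^ (M - k)"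
      using that by (auto simp flip: power_add)
    show ?thesis
      using nz[of k] nz[of "M - k"] pnz[of "M - k"]
      unfolding t_def * by (simp add: qpoch_Suc divide_simps)
  qed
  have B: "p ^ (M - k) * (1 - p ^ Suc k) * t a (Suc M) (Suc k)
      = - b * p ^ M * (1 - a) * t (a * p) M k" if "k \<le> M" for k
  proof -
    have 1: "Suc k choose 2 = k + (k choose 2)"
      by (simp add: numeral_2_eq_2)
    have 2: "p ^ M = p ^ k * p ^ (M - k)"
      using that by (auto simp flip: power_add)
    have 3: "a * b * p ^ Suc k = a * p * b * p ^ k"
      by simp
    show ?thesis
      using nz[of k] nz[of "M - k"] pnz[of k]
      unfolding t_def 1 2 3 qpoch_Suc_shift[of a p k] power_add diff_Suc_Suc
      by (simp add: qpoch_Suc divide_simps)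
  qed
  have split: "1 - p ^ Suc M = (1 - p ^ (Suc M - k)) + p ^ (Suc M - k) * (1 - p ^ k)"
    if "k \<le> Suc M" for k
    using that by (simp add: algebra_simps flip: power_add)
  have "(1 - p ^ Suc M) * (\<Sum>k\<le>Suc M. t a (Suc M) k)
      = (\<Sum>k\<le>Suc M. (1 - p ^ (Suc M - k)) * t a (Suc M) k)
        + (\<Sum>k\<le>Suc M. p ^ (Suc M - k) * (1 - p ^ k) * t a (Suc M) k)"
    unfolding sum_distrib_left sum.distrib[symmetric]
    by (intro sum.cong refl, subst split) (auto simp: algebra_simps)
  also have "(\<Sum>k\<le>Suc M. (1 - p ^ (Suc M - k)) * t a (Suc M) k)
      = (1 - a * b * p ^ M) * (\<Sum>k\<le>M. t a M k)"
    by (simp add: A sum_distrib_left)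
  also have "(\<Sum>k\<le>Suc M. p ^ (Suc M - k) * (1 - p ^ k) * t a (Suc M) k)
      = (\<Sum>k\<le>M. p ^ (M - k) * (1 - p ^ Suc k) * t a (Suc M) (Suc k))"
    by (subst sum.atMost_Suc_shift) simp
  also have "\<dots> = - b * p ^ M * (1 - a) * (\<Sum>k\<le>M. t (a * p) M k)"
    unfolding sum_distrib_left by (intro sum.cong refl B) auto
  \<comment> \<open>By \<open>IH\<close> both sums have the same value, free of \<open>a\<close>,
    and \<open>(1 - a b p^M) - b p^M (1 - a) = 1 - b p^M\<close>.\<close>
  also have "(1 - a * b * p ^ M) * (\<Sum>k\<le>M. t a M k) + \<dots>
      = qpoch b p M / qpoch p p M * (1 - b * p ^ M)"
    by (simp only: IH flip: distrib_right mult.assoc) (simp add: algebra_simps)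
  finally have "(\<Sum>k\<le>Suc M. t a (Suc M) k)
      = qpoch b p M / qpoch p p M * (1 - b * p ^ M) / (1 - p ^ Suc M)"
    by (subst nonzero_eq_divide_eq[OF pnz[of M]]) (simp only: mult.commute)
  then show ?case
    by (simp add: t_def qpoch_Suc)
qed

text \<open>The case \<open>a = 0\<close>, \<open>b = -x\<close> of q-Chu-Vandermonde, where every
  factor starting from \<open>0\<close> is 1.\<close>

lemma q_binomial_theorem:
  fixes p :: complex
  assumes "norm p < 1"
  shows "(\<Sum>k\<le>M. x ^ k * p ^ (k choose 2) * qpoch p p M / (qpoch p p k * qpoch p p (M - k)))
            = qpoch (- x) p M"
proof -
  have [simp]: "qpoch 0 p n = 1" for n
    by (simp add: qpoch_def)
  have "(\<Sum>k\<le>M. x ^ k * p ^ (k choose 2) * qpoch p p M / (qpoch p p k * qpoch p p (M - k)))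
      = qpoch p p M * (\<Sum>k\<le>M. x ^ k * p ^ (k choose 2) / (qpoch p p k * qpoch p p (M - k)))"
    by (simp add: sum_distrib_left mult_ac)
  then show ?thesis
    using q_Chu_Vandermonde[OF assms, of 0 "- x" M] qpoch_nonzero[OF assms] by simp
qed

section \<open>Bailey pairs and the Bailey chain for \<open>a = 1\<close>\<close>

text \<open>The coefficients of \<open>\<Sum>\<^sub>r h^(r^2) z^r\<close> over all integers \<open>r\<close>, with \<open>r\<close> and \<open>-r\<close> combined.\<close>

definition theta_coeff :: "complex \<Rightarrow> complex \<Rightarrow> nat \<Rightarrow> complex" where
  "theta_coeff h z r = (if r = 0 then 1 else h ^ r\<^sup>2 * (z ^ r + inverse z ^ r))"

text \<open>\<open>(\<alpha>, bailey_sum p \<alpha>)\<close> is a Bailey pair relative to \<open>a = 1\<close> in base \<open>p\<close>.\<close>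

definition bailey_sum :: "complex \<Rightarrow> (nat \<Rightarrow> complex) \<Rightarrow> nat \<Rightarrow> complex" where
  "bailey_sum p \<alpha> n = (\<Sum>r\<le>n. \<alpha> r / (qpoch p p (n - r) * qpoch p p (n + r)))"

text \<open>Applied to \<open>(-h;p)_n\<close> times the second member of a Bailey pair, with
  \<open>p = h^2\<close>, this is Bailey's lemma with one parameter \<open>-h\<close> and the other
  sent to infinity. Since \<open>p/(-h) = -h\<close>, the weight \<open>(-h;p)\<close> reappears in
  the result, so the step can be iterated.\<close>

definition bailey_step :: "complex \<Rightarrow> (nat \<Rightarrow> complex) \<Rightarrow> nat \<Rightarrow> complex" where
  "bailey_step h b L = (\<Sum>n\<le>L. h ^ n\<^sup>2 / qpoch (h\<^sup>2) (h\<^sup>2) (L - n) * b n)"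

lemma power_square_choose_two: "(h\<^sup>2) ^ (k choose 2) * h ^ k = h ^ k\<^sup>2" for h :: complex
proof (induction k)
  case (Suc k)
  have "Suc k choose 2 = (k choose 2) + k" "(Suc k)\<^sup>2 = k\<^sup>2 + k + k + 1"
    by (simp_all add: numeral_2_eq_2)
  then have "(h\<^sup>2) ^ (Suc k choose 2) * h ^ Suc k = ((h\<^sup>2) ^ (k choose 2) * h ^ k) * h ^ (k + k + 1)"
    by (simp add: power_add power2_eq_square power_mult_distrib)
  then show ?case
    using \<open>(Suc k)\<^sup>2 = k\<^sup>2 + k + k + 1\<close> by (simp add: Suc.IH power_add)
qed (simp add: binomial_eq_0)

text \<open>Writing \<open>n = r + k\<close> turns the sum into q-Chu-Vandermonde of length
  \<open>L - r\<close> with both parameters equal to \<open>u = -h^(2r+1)\<close>.\<close>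

lemma conjugate_bailey_pair:
  assumes "norm h < 1" "r \<le> L"
  shows "(\<Sum>n=r..L. qpoch (- h) (h\<^sup>2) n * h ^ n\<^sup>2
           / (qpoch (h\<^sup>2) (h\<^sup>2) (L - n) * qpoch (h\<^sup>2) (h\<^sup>2) (n - r) * qpoch (h\<^sup>2) (h\<^sup>2) (n + r)))
       = qpoch (- h) (h\<^sup>2) L * h ^ r\<^sup>2 / (qpoch (h\<^sup>2) (h\<^sup>2) (L - r) * qpoch (h\<^sup>2) (h\<^sup>2) (L + r))"
proof -
  define p where "p = h\<^sup>2"
  define M where "M = L - r"
  define u where "u = - (h ^ (2 * r + 1))"
  have p1: "norm p < 1"
    using assms(1) by (simp add: p_def norm_power power_less_one_iff)
  note nz = qpoch_nonzero[OF p1]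
  have L: "L = r + M"
    using assms(2) by (simp add: M_def)
  have u: "- h * p ^ r = u"
    by (simp add: p_def u_def power_mult)
  have uu: "p * p ^ (2 * r) = u * u"
    by (simp add: p_def u_def algebra_simps power_mult power2_eq_square power_mult_distrib)
  have *: "qpoch (- h) p (k + r) * h ^ (k + r)\<^sup>2
           / (qpoch p p (L - (k + r)) * qpoch p p ((k + r) - r) * qpoch p p ((k + r) + r))
     = qpoch (- h) p r * h ^ r\<^sup>2 / qpoch p p (L + r)
        * (qpoch u p k * (- u) ^ k * p ^ (k choose 2) * qpoch (u * u * p ^ k) p (M - k)
            / (qpoch p p k * qpoch p p (M - k)))" if "k \<le> M" for k
  proof -
    have 1: "qpoch (- h) p (k + r) = qpoch (- h) p r * qpoch u p k"
      by (metis qpoch_add u add.commute)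
    \<comment> \<open>As \<open>p^(2r+1) = u^2\<close>, the part of \<open>(p;p)\<close> of length
      \<open>L + r\<close> beyond the first \<open>k + 2r\<close> factors is exactly the factor in
      \<open>u * u * p ^ k\<close> that q-Chu-Vandermonde requires.\<close>
    have 2: "qpoch p p (L + r) = qpoch p p ((k + r) + r) * qpoch (u * u * p ^ k) p (M - k)"
    proof -
      have "L + r = (k + r + r) + (M - k)"
        using that L by simp
      moreover have "p * p ^ (k + r + r) = u * u * p ^ k"
        unfolding uu[symmetric] by (simp add: power_add mult_2)
      ultimately show ?thesis
        using qpoch_add[of p p "k + r + r" "M - k"] by (simp only:)
    qed
    have "(k + r)\<^sup>2 = r\<^sup>2 + 2 * r * k + k\<^sup>2"
      by (simp add: power2_eq_square algebra_simps)
    then have 3: "h ^ (k + r)\<^sup>2 = h ^ r\<^sup>2 * (- u) ^ k * p ^ (k choose 2)"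
      by (simp add: u_def p_def power_add power_mult power_mult_distrib
          flip: power_square_choose_two)
    have 4: "L - (k + r) = M - k" "(k + r) - r = k"
      by (auto simp: M_def)
    have "qpoch (u * u * p ^ k) p (M - k) \<noteq> 0"
      using 2 nz[of "L + r"] by auto
    then show ?thesis
      using nz unfolding 1 2 3 4 by (simp add: field_simps)
  qed
  have "(\<Sum>n=r..L. qpoch (- h) p n * h ^ n\<^sup>2 / (qpoch p p (L - n) * qpoch p p (n - r) * qpoch p p (n + r)))
     = (\<Sum>k\<le>M. qpoch (- h) p (k + r) * h ^ (k + r)\<^sup>2
           / (qpoch p p (L - (k + r)) * qpoch p p ((k + r) - r) * qpoch p p ((k + r) + r)))"
    by (rule sum.reindex_bij_witness[of _ "\<lambda>k. k + r" "\<lambda>n. n - r"]) (auto simp: L)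
  also have "\<dots> = qpoch (- h) p r * h ^ r\<^sup>2 / qpoch p p (L + r) * (qpoch u p M / qpoch p p M)"
    unfolding q_Chu_Vandermonde[OF p1, of u u M, symmetric] sum_distrib_left
    by (intro sum.cong refl *) auto
  also have "\<dots> = qpoch (- h) p L * h ^ r\<^sup>2 / (qpoch p p (L - r) * qpoch p p (L + r))"
    using qpoch_add[of "- h" p r M, unfolded u] by (simp add: L mult_ac)
  finally show ?thesis
    by (simp add: p_def)
qed

text \<open>Exchanging the two finite summations leaves \<open>conjugate_bailey_pair\<close> as the
  inner sum for each fixed \<open>r\<close>.\<close>

lemma bailey_step_bailey_sum:
  assumes "norm h < 1"
  shows "bailey_step h (\<lambda>n. qpoch (- h) (h\<^sup>2) n * bailey_sum (h\<^sup>2) \<alpha> n) L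
       = qpoch (- h) (h\<^sup>2) L * bailey_sum (h\<^sup>2) (\<lambda>r. h ^ r\<^sup>2 * \<alpha> r) L"
proof -
  let ?Q = "qpoch (h\<^sup>2) (h\<^sup>2)"
  have "bailey_step h (\<lambda>n. qpoch (- h) (h\<^sup>2) n * bailey_sum (h\<^sup>2) \<alpha> n) L
      = (\<Sum>n\<le>L. \<Sum>r\<le>n. \<alpha> r * (qpoch (- h) (h\<^sup>2) n * h ^ n\<^sup>2 / (?Q (L - n) * ?Q (n - r) * ?Q (n + r))))"
    by (simp add: bailey_step_def bailey_sum_def sum_distrib_left mult_ac)
  also have "\<dots> = (\<Sum>r\<le>L. \<Sum>n=r..L. \<alpha> r * (qpoch (- h) (h\<^sup>2) n * h ^ n\<^sup>2 / (?Q (L - n) * ?Q (n - r) * ?Q (n + r))))"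
    unfolding sum.Sigma[OF finite_atMost ballI[OF finite_atMost]]
      sum.Sigma[OF finite_atMost ballI[OF finite_atLeastAtMost]]
    by (rule sum.reindex_bij_witness[of _ "\<lambda>(a, b). (b, a)" "\<lambda>(a, b). (b, a)"]) auto
  also have "\<dots> = qpoch (- h) (h\<^sup>2) L * bailey_sum (h\<^sup>2) (\<lambda>r. h ^ r\<^sup>2 * \<alpha> r) L"
    unfolding bailey_sum_def sum_distrib_left[of "qpoch (- h) (h\<^sup>2) L"] sum_distrib_left[symmetric, of "\<alpha> _"]
    by (intro sum.cong refl) (simp add: conjugate_bailey_pair[OF assms])
  finally show ?thesis .
qed


section \<open>The finite Jacobi triple product\<close>

text \<open>Recentring at the middle index \<open>n\<close> pairs \<open>r\<close> with
  \<open>-r\<close> without using integer indices, in agreement with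
  \<open>theta_coeff\<close>.\<close>

lemma sum_symmetric_fold:
  fixes f :: "nat \<Rightarrow> 'a::comm_monoid_add"
  shows "(\<Sum>k\<le>2 * n. f k) = (\<Sum>r\<le>n. if r = 0 then f n else f (n + r) + f (n - r))"
proof -
  have "(\<Sum>k\<le>2 * n. f k) = (\<Sum>k<n. f k) + (\<Sum>k=n..2 * n. f k)"
    by (subst sum.union_disjoint[symmetric]) (auto intro!: sum.cong)
  also have "(\<Sum>k<n. f k) = (\<Sum>r=1..n. f (n - r))"
    by (rule sum.reindex_bij_witness[of _ "\<lambda>r. n - r" "\<lambda>k. n - k"]) auto
  also have "(\<Sum>k=n..2 * n. f k) = (\<Sum>r=0..n. f (n + r))"
    by (rule sum.reindex_bij_witness[of _ "\<lambda>r. n + r" "\<lambda>k. k - n"]) auto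
  also have "\<dots> = f n + (\<Sum>r=1..n. f (n + r))"
    by (simp add: sum.atLeast_Suc_atMost)
  also have "(\<Sum>r=1..n. f (n - r)) + \<dots> = f n + (\<Sum>r=1..n. f (n + r) + f (n - r))"
    by (simp add: sum.distrib algebra_simps)
  also have "\<dots> = (\<Sum>r=0..n. if r = 0 then f n else f (n + r) + f (n - r))"
    by (simp add: sum.atLeast_Suc_atMost)
  finally show ?thesis
    by (simp add: atMost_atLeast0)
qed

text \<open>The first \<open>n\<close> factors carry negative odd powers of \<open>h\<close>. Each
  is rewritten as \<open>1 + z h^(-e) = z h^(-e) (1 + h^e / z)\<close>, and the odd exponents
  \<open>e\<close> from \<open>1\<close> to \<open>2n - 1\<close> add up to
  \<open>n^2\<close>.\<close>

lemma qpoch_reflect: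
  fixes h z :: complex
  assumes "h \<noteq> 0" "z \<noteq> 0"
  shows "qpoch (- (z * h / h ^ (2 * n))) (h\<^sup>2) (2 * n)
       = z ^ n / h ^ n\<^sup>2 * qpoch (- (z * h)) (h\<^sup>2) n * qpoch (- (h / z)) (h\<^sup>2) n"
proof -
  have 1: "qpoch (- (z * h / h ^ (2 * n))) (h\<^sup>2) n = z ^ n / h ^ n\<^sup>2 * qpoch (- (h / z)) (h\<^sup>2) n"
  proof (induction n)
    case (Suc n)
    have *: "- (z * h / h ^ (2 * Suc n)) * h\<^sup>2 = - (z * h / h ^ (2 * n))"
      using assms by (simp add: power2_eq_square)
    have "(Suc n)\<^sup>2 = n\<^sup>2 + 2 * n + 1"
      by (simp add: power2_eq_square)
    then have "z ^ Suc n / h ^ (Suc n)\<^sup>2 * (1 + h / z * (h\<^sup>2) ^ n)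
        = z ^ n / h ^ n\<^sup>2 * (1 + z * h / h ^ (2 * Suc n))"
      using assms
      by (simp add: power_add divide_simps flip: power_mult)
    then show ?case
      by (simp only: qpoch_Suc_shift[of "- (z * h / h ^ (2 * Suc n))"] * Suc.IH)
        (simp add: qpoch_Suc mult_ac)
  qed auto
  have 2: "- (z * h / h ^ (2 * n)) * (h\<^sup>2) ^ n = - (z * h)"
    using assms by (simp flip: power_mult)
  show ?thesis
    unfolding mult_2[of n] qpoch_add[of _ _ n n] by (simp only: 1[unfolded mult_2] 2[unfolded mult_2]) simp
qed

text \<open>The q-binomial theorem for \<open>2n\<close> factors at \<open>x = z h^(1-2n)\<close>,
  with the index recentred at \<open>n\<close>. The prefactor \<open>z^n / h^(n^2)\<close> occurs on
  both sides and cancels.\<close>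

lemma finite_Jacobi_triple:
  assumes "norm h < 1" "h \<noteq> 0" "z \<noteq> 0"
  shows "bailey_sum (h\<^sup>2) (theta_coeff h z) n
       = qpoch (- (z * h)) (h\<^sup>2) n * qpoch (- (h / z)) (h\<^sup>2) n / qpoch (h\<^sup>2) (h\<^sup>2) (2 * n)"
proof -
  define p where "p = h\<^sup>2"
  define x where "x = z * h / h ^ (2 * n)"
  have p1: "norm p < 1"
    using assms(1) by (simp add: p_def norm_power power_less_one_iff)
  note nz = qpoch_nonzero[OF p1]
  define f where "f = (\<lambda>k. x ^ k * p ^ (k choose 2) / (qpoch p p k * qpoch p p (2 * n - k)))"
  have xk: "x ^ k * p ^ (k choose 2) * h ^ (2 * n * k) = z ^ k * h ^ k\<^sup>2" for k
  proof -
    have "x * h ^ (2 * n) = z * h"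
      using assms(2) by (simp add: x_def)
    then have "x ^ k * h ^ (2 * n * k) = z ^ k * h ^ k"
      by (simp only: power_mult flip: power_mult_distrib)
    moreover have "p ^ (k choose 2) * h ^ k = h ^ k\<^sup>2"
      by (simp add: p_def power_square_choose_two)
    ultimately show ?thesis
      by (metis mult.assoc mult.commute)
  qed
  have plus: "x ^ (n + r) * p ^ ((n + r) choose 2) = z ^ n / h ^ n\<^sup>2 * (h ^ r\<^sup>2 * z ^ r)" for r
  proof -
    \<comment> \<open>Completing the square: \<open>(n+r)^2 - 2n(n+r) = r^2 - n^2\<close>, stated
      additively because the exponents are natural numbers.\<close>
    have "(n + r)\<^sup>2 + n\<^sup>2 = 2 * n * (n + r) + r\<^sup>2"
      by (simp add: power2_eq_square algebra_simps)
    then have "h ^ (n + r)\<^sup>2 * h ^ n\<^sup>2 = h ^ (2 * n * (n + r)) * h ^ r\<^sup>2"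
      by (simp only: flip: power_add)
    then have quot: "h ^ (n + r)\<^sup>2 / h ^ (2 * n * (n + r)) = h ^ r\<^sup>2 / h ^ n\<^sup>2"
      using assms(2) by (simp add: frac_eq_eq mult.commute)
    have "x ^ (n + r) * p ^ ((n + r) choose 2) = z ^ (n + r) * h ^ (n + r)\<^sup>2 / h ^ (2 * n * (n + r))"
      using assms(2) by (simp flip: xk)
    also have "\<dots> = z ^ n / h ^ n\<^sup>2 * (h ^ r\<^sup>2 * z ^ r)"
      unfolding times_divide_eq_right[symmetric] quot by (simp add: power_add mult_ac)
    finally show ?thesis .
  qed
  have minus: "x ^ (n - r) * p ^ ((n - r) choose 2) = z ^ n / h ^ n\<^sup>2 * (h ^ r\<^sup>2 * inverse z ^ r)"
    if "r \<le> n" for r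
  proof -
    define m where "m = n - r"
    have n: "n = r + m"
      using that by (simp add: m_def)
    have "m\<^sup>2 + n\<^sup>2 = 2 * n * m + r\<^sup>2"
      unfolding n by (simp add: power2_eq_square algebra_simps)
    then have "h ^ m\<^sup>2 * h ^ n\<^sup>2 = h ^ (2 * n * m) * h ^ r\<^sup>2"
      by (simp only: flip: power_add)
    then have quot: "h ^ m\<^sup>2 / h ^ (2 * n * m) = h ^ r\<^sup>2 / h ^ n\<^sup>2"
      using assms(2) by (simp add: frac_eq_eq mult.commute)
    have zm: "z ^ m = z ^ n * inverse z ^ r"
      using assms(3) unfolding n by (simp add: power_add field_simps)
    have "x ^ m * p ^ (m choose 2) = z ^ m * h ^ m\<^sup>2 / h ^ (2 * n * m)"
      using assms(2) by (simp flip: xk)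
    also have "\<dots> = z ^ n / h ^ n\<^sup>2 * (h ^ r\<^sup>2 * inverse z ^ r)"
      unfolding times_divide_eq_right[symmetric] quot zm by (simp add: mult_ac)
    finally show ?thesis
      by (simp only: m_def)
  qed
  have fold: "(if r = 0 then f n else f (n + r) + f (n - r))
      = z ^ n / h ^ n\<^sup>2 * (theta_coeff h z r / (qpoch p p (n - r) * qpoch p p (n + r)))" if "r \<le> n" for r
  proof -
    have idx: "2 * n - (n + r) = n - r" "2 * n - (n - r) = n + r" "2 * n - n = n"
      using that by auto
    have "f (n + r) + f (n - r) = z ^ n / h ^ n\<^sup>2 *
        (h ^ r\<^sup>2 * (z ^ r + inverse z ^ r) / (qpoch p p (n - r) * qpoch p p (n + r)))"
      unfolding f_def idx plus minus[OF that] by (simp add: add_divide_distrib distrib_left mult_ac)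
    moreover have "f n = z ^ n / h ^ n\<^sup>2 * (1 / (qpoch p p n * qpoch p p n))"
      unfolding f_def idx using plus[of 0] by simp
    ultimately show ?thesis
      by (simp add: theta_coeff_def)
  qed
  have "z ^ n / h ^ n\<^sup>2 * bailey_sum p (theta_coeff h z) n = (\<Sum>k\<le>2 * n. f k)"
    unfolding sum_symmetric_fold bailey_sum_def sum_distrib_left by (intro sum.cong) (auto simp: fold)
  also have "\<dots> = qpoch (- x) p (2 * n) / qpoch p p (2 * n)"
    using nz[of "2 * n"]
    by (simp add: f_def q_binomial_theorem[OF p1, symmetric] sum_divide_distrib)
  also have "\<dots> = z ^ n / h ^ n\<^sup>2 * (qpoch (- (z * h)) p n * qpoch (- (h / z)) p n / qpoch p p (2 * n))"
    using qpoch_reflect[OF assms(2,3), of n] by (simp add: p_def x_def)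
  finally show ?thesis
    using assms(2,3) by (subst (asm) mult_left_cancel) (simp_all add: p_def)
qed

section \<open>Limits of Bailey sums and the Jacobi triple product\<close>

lemma tendsto_sum_tannery:
  fixes f :: "nat \<Rightarrow> complex"
  assumes "summable (\<lambda>r. norm (f r))"
    and "\<And>L r. r \<le> L \<Longrightarrow> norm (g L r) \<le> K"
    and "\<And>r. (\<lambda>L. g L r) \<longlonglongrightarrow> c"
  shows "(\<lambda>L. \<Sum>r\<le>L. f r * g L r) \<longlonglongrightarrow> suminf f * c"
proof -
  \<comment> \<open>Extending by zero beyond \<open>L\<close> replaces the growing range by a fixed
    one, as dominated convergence of series requires.\<close>
  define a where "a = (\<lambda>r L. if r \<le> L then f r * g L r else 0)"
  have "0 \<le> K"
    using order_trans[OF norm_ge_zero assms(2)[OF order_refl]] .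
  then have "norm (a r L) \<le> norm (f r) * K" for r L
    by (auto simp: a_def norm_mult intro!: mult_left_mono assms(2))
  moreover have "(\<lambda>L. a r L) \<longlonglongrightarrow> f r * c" for r
  proof (rule Lim_transform_eventually)
    show "(\<lambda>L. f r * g L r) \<longlonglongrightarrow> f r * c"
      by (intro tendsto_intros assms(3))
    show "\<forall>\<^sub>F L in sequentially. f r * g L r = a r L"
      using eventually_ge_at_top[of r] by eventually_elim (auto simp: a_def)
  qed
  ultimately have "(\<lambda>L. \<Sum>r. a r L) \<longlonglongrightarrow> (\<Sum>r. f r * c)"
    using tannerys_theorem[of a "\<lambda>r. f r * c" sequentially "\<lambda>r. norm (f r) * K"]
    by (simp add: always_eventually case_prod_beta summable_mult2 assms(1))
  moreover have "(\<Sum>r. a r L) = (\<Sum>r\<le>L. f r * g L r)" for L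
    by (subst suminf_finite[of "{..L}"]) (auto simp: a_def)
  ultimately show ?thesis
    using suminf_mult2[OF summable_norm_cancel[OF assms(1)], of c] by simp
qed

lemma filterlim_diff_const_nat: "filterlim (\<lambda>L. L - r) at_top (sequentially :: nat filter)"
  unfolding filterlim_at_top
  by (metis (mono_tags, lifting) eventually_sequentiallyI le_diff_conv2 add_leD2)

lemma bailey_sum_LIMSEQ:
  assumes "norm p < 1" "summable (\<lambda>r. norm (\<alpha> r))"
  shows "bailey_sum p \<alpha> \<longlonglongrightarrow> suminf \<alpha> / (qpoch_inf p p)\<^sup>2"
proof -
  obtain K where K: "K > 0" "\<And>n. norm (inverse (qpoch p p n)) \<le> K"
    using inverse_qpoch_bounded[OF assms(1)] by blast
  have "(\<lambda>L. \<Sum>r\<le>L. \<alpha> r * (inverse (qpoch p p (L - r)) * inverse (qpoch p p (L + r))))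
        \<longlonglongrightarrow> suminf \<alpha> * (inverse (qpoch_inf p p) * inverse (qpoch_inf p p))"
  proof (rule tendsto_sum_tannery[OF assms(2)])
    show "norm (inverse (qpoch p p (L - r)) * inverse (qpoch p p (L + r))) \<le> K * K" for L r
      unfolding norm_mult using K by (intro mult_mono) auto
    show "(\<lambda>L. inverse (qpoch p p (L - r)) * inverse (qpoch p p (L + r)))
        \<longlonglongrightarrow> inverse (qpoch_inf p p) * inverse (qpoch_inf p p)" for r
      using assms(1) qpoch_inf_nonzero[OF assms(1)]
      by (intro tendsto_intros qpoch_LIMSEQ_comp filterlim_diff_const_nat
          filterlim_add_const_nat_at_top)
  qed
  then show ?thesis
    by (simp add: bailey_sum_def[abs_def] field_simps power2_eq_square)
qed

lemma norm_power_square_le: "norm h < 1 \<Longrightarrow> norm (h ^ n\<^sup>2) \<le> norm h ^ n" for h :: complex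
  unfolding norm_power by (intro power_decreasing) (auto simp: power2_eq_square)

lemma summable_norm_square_power:
  fixes h :: complex
  assumes "norm h < 1" "Bseq b"
  shows "summable (\<lambda>n. norm (h ^ n\<^sup>2 * b n))"
proof -
  obtain B where B: "norm (b n) \<le> B" for n
    using assms(2) by (auto simp: Bseq_def)
  show ?thesis
  proof (rule summable_comparison_test')
    show "summable (\<lambda>n. norm h ^ n * B)"
      using assms(1) by (intro summable_mult2 summable_geometric) simp
    show "norm (norm (h ^ n\<^sup>2 * b n)) \<le> norm h ^ n * B" for n
      using assms(1) B by (auto simp: norm_mult intro!: mult_mono norm_power_square_le)
  qed
qed

text \<open>For fixed \<open>n\<close> the factor of length \<open>L - n\<close> tends to the
  infinite product, so the bounded summation becomes an unrestricted one. Read backwards, this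
  evaluates the outermost summation of the multiple sum.\<close>

lemma bailey_step_LIMSEQ:
  assumes "norm h < 1" "Bseq b"
  shows "bailey_step h b \<longlonglongrightarrow> (\<Sum>n. h ^ n\<^sup>2 * b n) / qpoch_inf (h\<^sup>2) (h\<^sup>2)"
proof -
  have p1: "norm (h\<^sup>2) < 1"
    using assms(1) by (simp add: norm_power power_less_one_iff)
  obtain K where K: "K > 0" "\<And>n. norm (inverse (qpoch (h\<^sup>2) (h\<^sup>2) n)) \<le> K"
    using inverse_qpoch_bounded[OF p1] by blast
  have "(\<lambda>L. \<Sum>n\<le>L. (h ^ n\<^sup>2 * b n) * inverse (qpoch (h\<^sup>2) (h\<^sup>2) (L - n)))
     \<longlonglongrightarrow> (\<Sum>n. h ^ n\<^sup>2 * b n) * inverse (qpoch_inf (h\<^sup>2) (h\<^sup>2))"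
    using p1 qpoch_inf_nonzero[OF p1] summable_norm_square_power[OF assms] K
    by (intro tendsto_sum_tannery[where K = K] tendsto_intros qpoch_LIMSEQ_comp filterlim_diff_const_nat) auto
  then show ?thesis
    by (simp add: bailey_step_def[abs_def] field_simps)
qed

text \<open>Boundedness is what convergence of the multiple sum asks of \<open>b\<close>; its
  preservation keeps the induction over the indices going.\<close>

lemma bailey_step_bounded:
  assumes "norm h < 1" "Bseq b"
  shows "Bseq (bailey_step h b)"
  using bailey_step_LIMSEQ[OF assms] by (intro convergent_imp_Bseq convergentI)

text \<open>Both sides of \<open>finite_Jacobi_triple\<close> are followed to infinity: the sum side
  by \<open>bailey_sum_LIMSEQ\<close>, the product side factor by factor.\<close>

lemma Jacobi_triple:
  assumes "norm h < 1" "h \<noteq> 0" "z \<noteq> 0" "summable (\<lambda>r. norm (theta_coeff h z r))"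
  shows "(\<Sum>r. theta_coeff h z r)
       = qpoch_inf (h\<^sup>2) (h\<^sup>2) * qpoch_inf (- (z * h)) (h\<^sup>2) * qpoch_inf (- (h / z)) (h\<^sup>2)"
proof -
  have p1: "norm (h\<^sup>2) < 1"
    using assms(1) by (simp add: norm_power power_less_one_iff)
  note nz = qpoch_inf_nonzero[OF p1]
  have "filterlim (\<lambda>n::nat. 2 * n) at_top sequentially"
    by (rule filterlim_subseq) (simp add: strict_mono_def)
  then have "bailey_sum (h\<^sup>2) (theta_coeff h z) \<longlonglongrightarrow> 
      qpoch_inf (- (z * h)) (h\<^sup>2) * qpoch_inf (- (h / z)) (h\<^sup>2) / qpoch_inf (h\<^sup>2) (h\<^sup>2)"
    unfolding finite_Jacobi_triple[OF assms(1-3), abs_def]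
    using nz p1 by (intro tendsto_intros qpoch_LIMSEQ qpoch_LIMSEQ_comp)
  from LIMSEQ_unique[OF bailey_sum_LIMSEQ[OF p1 assms(4)] this] show ?thesis
    using nz by (simp add: field_simps power2_eq_square)
qed


section \<open>Convergence and iterated evaluation of the multiple sum\<close>

text \<open>The dependence on the last index is left as an arbitrary \<open>b\<close>, so that
  summing out that index gives the same shape with one index fewer and \<open>b\<close> replaced by
  \<open>bailey_step h b\<close>.\<close>

definition multisum_term :: "complex \<Rightarrow> (nat \<Rightarrow> complex) \<Rightarrow> nat \<Rightarrow> (nat \<Rightarrow> nat) \<Rightarrow> complex" where
  "multisum_term h b \<nu> n = h ^ (\<Sum>k=1..\<nu>. (tail_sum \<nu> n k)\<^sup>2) * b (n \<nu>)
     / (\<Prod>k=1..<\<nu>. qpoch (h\<^sup>2) (h\<^sup>2) (n k))"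

text \<open>Since \<open>n k\<close> is at most the square of its tail sum, the terms are dominated
  by a product of geometric series. This justifies regrouping the multiple sum.\<close>

lemma multisum_term_summable:
  assumes "norm h < 1" "Bseq b"
  shows "multisum_term h b \<nu> summable_on PiE {1..\<nu>} (\<lambda>_. UNIV)"
proof -
  have p1: "norm (h\<^sup>2) < 1"
    using assms(1) by (simp add: norm_power power_less_one_iff)
  obtain K where K: "K > 0" "\<And>n. norm (inverse (qpoch (h\<^sup>2) (h\<^sup>2) n)) \<le> K"
    using inverse_qpoch_bounded[OF p1] by blast
  obtain B where B: "norm (b n) \<le> B" for n
    using assms(2) by (auto simp: Bseq_def)
  have "Infinite_Set_Sum.abs_summable_on (\<lambda>n. norm h ^ n) (UNIV :: nat set)"
    using assms(1) by (simp add: abs_summable_on_nat_iff' summable_geometric)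
  then have "Infinite_Set_Sum.abs_summable_on (\<lambda>n. \<Prod>k=1..\<nu>. norm h ^ n k) (PiE {1..\<nu>} (\<lambda>_. UNIV :: nat set))"
    by (intro abs_summable_on_prod_PiE) auto
  then have "(\<lambda>n. norm (\<Prod>k=1..\<nu>. norm h ^ n k)) summable_on (PiE {1..\<nu>} (\<lambda>_. UNIV :: nat set))"
    by (simp only: abs_summable_equivalent)
  then have "(\<lambda>n. norm (\<Prod>k=1..\<nu>. norm h ^ n k) * (B * K ^ (\<nu> - 1)))
      summable_on (PiE {1..\<nu>} (\<lambda>_. UNIV :: nat set))"
    by (rule summable_on_cmult_left)
  then have "(\<lambda>n. norm (multisum_term h b \<nu> n)) summable_on (PiE {1..\<nu>} (\<lambda>_. UNIV))"
  proof (rule Infinite_Sum.abs_summable_on_comparison_test')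
    fix n :: "nat \<Rightarrow> nat"
    have "n k \<le> (tail_sum \<nu> n k)\<^sup>2" if "k \<in> {1..\<nu>}" for k
    proof -
      have "n k \<le> tail_sum \<nu> n k"
        unfolding tail_sum_def using that by (intro member_le_sum) auto
      then show ?thesis
        by (rule order_trans) (simp add: power2_eq_square)
    qed
    then have "norm h ^ (\<Sum>k=1..\<nu>. (tail_sum \<nu> n k)\<^sup>2) \<le> norm h ^ (\<Sum>k=1..\<nu>. n k)"
      using assms(1) by (intro power_decreasing sum_mono) auto
    moreover have "(\<Prod>k=1..<\<nu>. norm (inverse (qpoch (h\<^sup>2) (h\<^sup>2) (n k)))) \<le> (\<Prod>k=1..<\<nu>. K)"
      using K by (intro prod_mono) auto
    ultimately have "norm h ^ (\<Sum>k=1..\<nu>. (tail_sum \<nu> n k)\<^sup>2)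
        * (norm (b (n \<nu>)) * (\<Prod>k=1..<\<nu>. norm (inverse (qpoch (h\<^sup>2) (h\<^sup>2) (n k)))))
      \<le> norm h ^ (\<Sum>k=1..\<nu>. n k) * (B * K ^ (\<nu> - 1))"
      using B order_trans[OF norm_ge_zero B]
      by (intro mult_mono mult_nonneg_nonneg prod_nonneg) auto
    also have "norm h ^ (\<Sum>k=1..\<nu>. (tail_sum \<nu> n k)\<^sup>2)
        * (norm (b (n \<nu>)) * (\<Prod>k=1..<\<nu>. norm (inverse (qpoch (h\<^sup>2) (h\<^sup>2) (n k)))))
      = norm (multisum_term h b \<nu> n)"
      by (simp add: multisum_term_def norm_mult norm_divide norm_power norm_inverse
          divide_inverse prod_inversef[unfolded o_def] mult_ac flip: prod_norm)
    finally show "norm (multisum_term h b \<nu> n) \<le> norm (\<Prod>k=1..\<nu>. norm h ^ n k) * (B * K ^ (\<nu> - 1))"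
      by (simp add: power_sum abs_prod)
  qed
  then show ?thesis
    by (rule abs_summable_summable)
qed

text \<open>Substituting \<open>n\<^sub>\<nu> + n\<^sub>\<nu>\<^sub>+\<^sub>1\<close> for \<open>n\<^sub>\<nu>\<close> makes the innermost summation the finite sum of \<open>bailey_step\<close>.\<close>

lemma multisum_term_has_sum_step:
  assumes "norm h < 1" "Bseq b" "\<nu> \<ge> 1"
    and "(multisum_term h (bailey_step h b) \<nu> has_sum S) (PiE {1..\<nu>} (\<lambda>_. UNIV))"
  shows "(multisum_term h b (Suc \<nu>) has_sum S) (PiE {1..Suc \<nu>} (\<lambda>_. UNIV))"
proof -
  let ?Q = "qpoch (h\<^sup>2) (h\<^sup>2)"
  define \<phi> :: "(nat \<Rightarrow> nat) \<times> nat \<Rightarrow> nat \<Rightarrow> nat"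
    where "\<phi> = (\<lambda>(m, j). m(\<nu> := m \<nu> - j, Suc \<nu> := j))"
  \<comment> \<open>The restriction resets the value at \<open>Suc \<nu>\<close> to
    \<open>undefined\<close>, as membership in the smaller product set demands.\<close>
  define \<psi> :: "(nat \<Rightarrow> nat) \<Rightarrow> (nat \<Rightarrow> nat) \<times> nat"
    where "\<psi> = (\<lambda>n. (restrict (n(\<nu> := n \<nu> + n (Suc \<nu>))) {1..\<nu>}, n (Suc \<nu>)))"
  let ?A = "PiE {1..\<nu>} (\<lambda>_. UNIV :: nat set)"
  let ?S = "Sigma ?A (\<lambda>m. {..m \<nu>})"
  have bij: "bij_betw \<phi> ?S (PiE {1..Suc \<nu>} (\<lambda>_. UNIV))"
  proof (rule bij_betw_byWitness[where f' = \<psi>])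
    show "\<forall>a\<in>?S. \<psi> (\<phi> a) = a"
      by (auto simp: \<phi>_def \<psi>_def fun_eq_iff PiE_def extensional_def)
    show "\<forall>n\<in>PiE {1..Suc \<nu>} (\<lambda>_. UNIV). \<phi> (\<psi> n) = n"
      using assms(3) by (auto simp: \<phi>_def \<psi>_def fun_eq_iff PiE_def extensional_def)
    show "\<phi> ` ?S \<subseteq> PiE {1..Suc \<nu>} (\<lambda>_. UNIV)"
      using assms(3) by (auto simp: \<phi>_def PiE_def extensional_def)
    show "\<psi> ` PiE {1..Suc \<nu>} (\<lambda>_. UNIV) \<subseteq> ?S"
      using assms(3) by (auto simp: \<psi>_def)
  qed
  have summand: "multisum_term h b (Suc \<nu>) (\<phi> (m, j))
      = h ^ (\<Sum>k=1..\<nu>. (tail_sum \<nu> m k)\<^sup>2) / (\<Prod>k=1..<\<nu>. ?Q (m k))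
        * (h ^ j\<^sup>2 / ?Q (m \<nu> - j) * b j)" if "j \<le> m \<nu>" for m j
  proof -
    \<comment> \<open>The entries at \<open>\<nu>\<close> and \<open>Suc \<nu>\<close> add up to
      \<open>m \<nu>\<close>; the bound \<open>j \<le> m \<nu>\<close> makes the natural subtraction
      exact.\<close>
    have 1: "tail_sum (Suc \<nu>) (\<phi> (m, j)) k = tail_sum \<nu> m k" if "k \<in> {1..\<nu>}" for k
    proof -
      have "{k..\<nu>} = insert \<nu> {k..<\<nu>}"
        using that by auto
      then show ?thesis
        using that \<open>j \<le> m \<nu>\<close> by (simp add: tail_sum_def \<phi>_def)
    qed
    have 2: "tail_sum (Suc \<nu>) (\<phi> (m, j)) (Suc \<nu>) = j"
      by (simp add: tail_sum_def \<phi>_def)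
    have "{1..<Suc \<nu>} = insert \<nu> {1..<\<nu>}"
      using assms(3) by auto
    then have 3: "(\<Prod>k=1..<Suc \<nu>. ?Q (\<phi> (m, j) k)) = ?Q (m \<nu> - j) * (\<Prod>k=1..<\<nu>. ?Q (m k))"
      by (simp add: \<phi>_def)
    have 4: "(\<Sum>k=1..Suc \<nu>. (tail_sum (Suc \<nu>) (\<phi> (m, j)) k)\<^sup>2) = (\<Sum>k=1..\<nu>. (tail_sum \<nu> m k)\<^sup>2) + j\<^sup>2"
      by (simp add: 1 2)
    have 5: "\<phi> (m, j) (Suc \<nu>) = j"
      by (simp add: \<phi>_def)
    show ?thesis
      unfolding multisum_term_def 3 4 5 by (simp add: power_add mult_ac)
  qed
  have "((\<lambda>x. multisum_term h b (Suc \<nu>) (\<phi> x)) has_sum S) ?S"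
  proof (rule has_sum_SigmaI)
    show "((\<lambda>j. multisum_term h b (Suc \<nu>) (\<phi> (m, j))) has_sum multisum_term h (bailey_step h b) \<nu> m) {..m \<nu>}"
      for m
    proof (rule has_sum_finiteI)
      have "(\<Sum>j\<le>m \<nu>. multisum_term h b (Suc \<nu>) (\<phi> (m, j)))
          = h ^ (\<Sum>k=1..\<nu>. (tail_sum \<nu> m k)\<^sup>2) / (\<Prod>k=1..<\<nu>. ?Q (m k)) * bailey_step h b (m \<nu>)"
        unfolding bailey_step_def sum_distrib_left by (intro sum.cong refl summand) auto
      then show "multisum_term h (bailey_step h b) \<nu> m = (\<Sum>j\<le>m \<nu>. multisum_term h b (Suc \<nu>) (\<phi> (m, j)))"
        by (simp add: multisum_term_def)
    qed simp
    show "(\<lambda>x. multisum_term h b (Suc \<nu>) (\<phi> x)) summable_on ?S"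
      unfolding summable_on_reindex_bij_betw[OF bij] by (rule multisum_term_summable[OF assms(1,2)])
  qed (rule assms(4))
  then show ?thesis
    unfolding has_sum_reindex_bij_betw[OF bij] .
qed

text \<open>Induction on the number of indices, with \<open>b\<close> general because each step
  changes it. With a single index left, the sum is an ordinary series.\<close>

lemma multisum_term_has_sum:
  assumes "norm h < 1" "Bseq b"
  shows "(multisum_term h b (Suc k) has_sum (\<Sum>n. h ^ n\<^sup>2 * (bailey_step h ^^ k) b n))
           (PiE {1..Suc k} (\<lambda>_. UNIV))"
  using assms(2)
proof (induction k arbitrary: b)
  case 0
  note abs_summable = summable_norm_square_power[OF assms(1) 0]
  have sum: "((\<lambda>n. h ^ n\<^sup>2 * b n) has_sum (\<Sum>n. h ^ n\<^sup>2 * b n)) UNIV"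
    by (rule norm_summable_imp_has_sum[OF abs_summable summable_sums[OF summable_norm_cancel[OF abs_summable]]])
  have bij: "bij_betw (\<lambda>n. n 1) (PiE {1 :: nat} (\<lambda>_. UNIV :: nat set)) UNIV"
    by (rule bij_betw_byWitness[where f' = "\<lambda>j. \<lambda>k\<in>{1}. j"])
      (auto simp: PiE_def extensional_def restrict_def)
  have "multisum_term h b 1 = (\<lambda>n. h ^ (n 1)\<^sup>2 * b (n 1))"
    by (rule ext) (simp add: multisum_term_def tail_sum_def)
  then show ?case
    using has_sum_reindex_bij_betw[THEN iffD2, OF bij sum] by simp
next
  case (Suc k)
  have "(multisum_term h (bailey_step h b) (Suc k)
      has_sum (\<Sum>n. h ^ n\<^sup>2 * (bailey_step h ^^ k) (bailey_step h b) n)) (PiE {1..Suc k} (\<lambda>_. UNIV))"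
    by (rule Suc.IH[OF bailey_step_bounded[OF assms(1) Suc.prems]])
  from multisum_term_has_sum_step[OF assms(1) Suc.prems _ this] show ?case
    by (simp only: funpow_Suc_right o_apply)
qed

section \<open>Running the chain on theta coefficients\<close>

lemma theta_coeff_step: "h ^ r\<^sup>2 * theta_coeff (h ^ m) z r = theta_coeff (h ^ Suc m) z r"
  by (simp add: theta_coeff_def power_mult_distrib)

lemma bailey_step_theta:
  assumes "norm h < 1"
  shows "(bailey_step h ^^ k) (\<lambda>n. qpoch (- h) (h\<^sup>2) n * bailey_sum (h\<^sup>2) (theta_coeff h z) n)
       = (\<lambda>n. qpoch (- h) (h\<^sup>2) n * bailey_sum (h\<^sup>2) (theta_coeff (h ^ Suc k) z) n)"
proof (induction k)
  case (Suc k)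
  show ?case
    unfolding funpow.simps o_apply Suc.IH
    by (rule ext) (simp only: bailey_step_bailey_sum[OF assms] theta_coeff_step)
qed simp

text \<open>The remaining series over \<open>b k\<close> is obtained by comparing two limits of the
  next sequence \<open>b (Suc k)\<close>. This extra step is why \<open>Suc k\<close> indices lead
  to the exponent \<open>k + 2\<close>.\<close>

lemma multisum_theta_has_sum:
  assumes "norm h < 1" "\<And>m. m > 0 \<Longrightarrow> summable (\<lambda>r. norm (theta_coeff (h ^ m) z r))"
    and "h \<noteq> 0" "z \<noteq> 0"
  shows "(multisum_term h (\<lambda>n. qpoch (- h) (h\<^sup>2) n * bailey_sum (h\<^sup>2) (theta_coeff h z) n) (Suc k)
      has_sum qpoch_inf (- h) (h\<^sup>2) / qpoch_inf (h\<^sup>2) (h\<^sup>2) * (\<Sum>r. theta_coeff (h ^ (k + 2)) z r))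
      (PiE {1..Suc k} (\<lambda>_. UNIV))"
proof -
  have p1: "norm (h\<^sup>2) < 1"
    using assms(1) by (simp add: norm_power power_less_one_iff)
  note nz = qpoch_inf_nonzero[OF p1]
  define b where "b = (\<lambda>k n. qpoch (- h) (h\<^sup>2) n * bailey_sum (h\<^sup>2) (theta_coeff (h ^ Suc k) z) n)"
  have lim: "b k \<longlonglongrightarrow> qpoch_inf (- h) (h\<^sup>2) * ((\<Sum>r. theta_coeff (h ^ Suc k) z r) / (qpoch_inf (h\<^sup>2) (h\<^sup>2))\<^sup>2)" for k
    unfolding b_def using assms p1 assms(2)[of "Suc k"] by (intro tendsto_mult qpoch_LIMSEQ bailey_sum_LIMSEQ) auto
  have bounded: "Bseq (b k)" for k
    by (rule convergent_imp_Bseq[OF convergentI[OF lim]])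
  have step: "(bailey_step h ^^ k) (b 0) = b k" for k
    using bailey_step_theta[OF assms(1), of k z] by (simp add: b_def)
  have step': "bailey_step h (b k) = b (Suc k)" for k
    using step[of k] step[of "Suc k"] by simp
  have "(\<Sum>n. h ^ n\<^sup>2 * b k n) / qpoch_inf (h\<^sup>2) (h\<^sup>2)
      = qpoch_inf (- h) (h\<^sup>2) * ((\<Sum>r. theta_coeff (h ^ (k + 2)) z r) / (qpoch_inf (h\<^sup>2) (h\<^sup>2))\<^sup>2)"
    using LIMSEQ_unique[OF bailey_step_LIMSEQ[OF assms(1) bounded[of k], unfolded step'] lim] by simp
  then have "(\<Sum>n. h ^ n\<^sup>2 * b k n)
      = qpoch_inf (- h) (h\<^sup>2) / qpoch_inf (h\<^sup>2) (h\<^sup>2) * (\<Sum>r. theta_coeff (h ^ (k + 2)) z r)"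
    using nz by (simp add: field_simps power2_eq_square)
  then show ?thesis
    using multisum_term_has_sum[OF assms(1) bounded[of 0], of k] unfolding step by (simp add: b_def)
qed

section \<open>Dissections of products and specialisation to \<open>q\<close>\<close>

lemma qpoch_triple:
  "qpoch a q (3 * n) = qpoch a (q ^ 3) n * qpoch (a * q) (q ^ 3) n * qpoch (a * q\<^sup>2) (q ^ 3) n"
proof (induction n)
  case (Suc n)
  have "3 * Suc n = Suc (Suc (Suc (3 * n)))"
    by simp
  then have "qpoch a q (3 * Suc n) = qpoch a q (3 * n) * (1 - a * q ^ (3 * n))
      * (1 - a * q * q ^ (3 * n)) * (1 - a * q\<^sup>2 * q ^ (3 * n))"
    by (simp only: qpoch_Suc power_Suc power2_eq_square mult.assoc)
  then show ?case
    unfolding Suc.IH qpoch_Suc power_mult[symmetric] by (simp only: mult_ac)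
qed simp

lemma qpoch_double: "qpoch a q (2 * n) = qpoch a (q\<^sup>2) n * qpoch (a * q) (q\<^sup>2) n"
proof (induction n)
  case (Suc n)
  have "2 * Suc n = Suc (Suc (2 * n))"
    by simp
  then have "qpoch a q (2 * Suc n) = qpoch a q (2 * n) * (1 - a * q ^ (2 * n)) * (1 - a * q * q ^ (2 * n))"
    by (simp only: qpoch_Suc power_Suc mult.assoc)
  then show ?case
    unfolding Suc.IH qpoch_Suc power_mult[symmetric] by (simp only: mult_ac)
qed simp

lemma qpoch_square: "qpoch (a\<^sup>2) (q\<^sup>2) n = qpoch a q n * qpoch (- a) q n"
  by (induction n) (simp_all add: qpoch_Suc algebra_simps power2_eq_square power_mult_distrib)

text \<open>Splitting \<open>(-h;h)\<close> by parity and \<open>(h^4;h^4)\<close> as a difference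
  of squares produces the common factor \<open>(-h^2;h^2)\<close>, which cancels.\<close>

lemma qpoch_inf_quotient_even:
  assumes "norm h < 1"
  shows "qpoch_inf (- h) h / qpoch_inf (h ^ 4) (h ^ 4) = qpoch_inf (- h) (h\<^sup>2) / qpoch_inf (h\<^sup>2) (h\<^sup>2)"
proof -
  have p1: "norm (h\<^sup>2) < 1" "norm (h ^ 4) < 1"
    using assms by (simp_all add: norm_power power_less_one_iff)
  have h4: "h ^ 4 = (h\<^sup>2)\<^sup>2"
    by simp
  have sub: "filterlim (\<lambda>n::nat. 2 * n) at_top sequentially"
    by (rule filterlim_subseq) (simp add: strict_mono_def)
  have "(\<lambda>n. qpoch (- h) (h\<^sup>2) n * qpoch (- (h\<^sup>2)) (h\<^sup>2) n)
      \<longlonglongrightarrow> qpoch_inf (- h) (h\<^sup>2) * qpoch_inf (- (h\<^sup>2)) (h\<^sup>2)"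
    using p1 by (intro tendsto_mult qpoch_LIMSEQ)
  moreover have "(\<lambda>n. qpoch (- h) (h\<^sup>2) n * qpoch (- (h\<^sup>2)) (h\<^sup>2) n) \<longlonglongrightarrow> qpoch_inf (- h) h"
    using qpoch_LIMSEQ_comp[OF assms sub, of "- h"] by (simp add: qpoch_double power2_eq_square)
  ultimately have 1: "qpoch_inf (- h) h = qpoch_inf (- h) (h\<^sup>2) * qpoch_inf (- (h\<^sup>2)) (h\<^sup>2)"
    by (rule LIMSEQ_unique[symmetric])
  have "(\<lambda>n. qpoch (h\<^sup>2) (h\<^sup>2) n * qpoch (- (h\<^sup>2)) (h\<^sup>2) n)
      \<longlonglongrightarrow> qpoch_inf (h\<^sup>2) (h\<^sup>2) * qpoch_inf (- (h\<^sup>2)) (h\<^sup>2)"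
    using p1 by (intro tendsto_mult qpoch_LIMSEQ)
  moreover have "(\<lambda>n. qpoch (h\<^sup>2) (h\<^sup>2) n * qpoch (- (h\<^sup>2)) (h\<^sup>2) n) \<longlonglongrightarrow> qpoch_inf (h ^ 4) (h ^ 4)"
    using qpoch_LIMSEQ[OF p1(2), of "h ^ 4"] unfolding h4 qpoch_square .
  ultimately have 2: "qpoch_inf (h ^ 4) (h ^ 4) = qpoch_inf (h\<^sup>2) (h\<^sup>2) * qpoch_inf (- (h\<^sup>2)) (h\<^sup>2)"
    by (rule LIMSEQ_unique[symmetric])
  show ?thesis
    using qpoch_inf_nonzero[OF p1(2)] unfolding 1 2 by simp
qed

text \<open>For \<open>r > 0\<close> the two terms are \<open>q^(3mr^2 + 2r)\<close> and
  \<open>q^(3mr^2 - 2r)\<close>; as \<open>3mr^2\<close> is at least \<open>3r\<close>, both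
  exponents are at least \<open>r\<close>.\<close>

lemma theta_coeff_summable:
  assumes "norm q < 1" "q \<noteq> 0" "m > 0"
  shows "summable (\<lambda>r. norm (theta_coeff ((q ^ 3) ^ m) (q\<^sup>2) r))"
proof (rule summable_comparison_test')
  show "summable (\<lambda>r. 2 * norm q ^ r)"
    using assms(1) by (intro summable_mult summable_geometric) simp
  show "norm (norm (theta_coeff ((q ^ 3) ^ m) (q\<^sup>2) r)) \<le> 2 * norm q ^ r" if "r \<ge> 0" for r
  proof (cases "r = 0")
    case False
    let ?e = "3 * m * r\<^sup>2"
    have e: "?e \<ge> 3 * r"
      using assms(3) False by (simp add: power2_eq_square)
    have "((q ^ 3) ^ m) ^ r\<^sup>2 * (q\<^sup>2) ^ r = q ^ (?e + 2 * r)"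
      by (simp add: power_add mult.assoc flip: power_mult)
    moreover have "((q ^ 3) ^ m) ^ r\<^sup>2 * inverse (q\<^sup>2) ^ r = q ^ (?e - 2 * r)"
      using assms(2) e by (simp add: power_diff field_simps flip: power_mult)
    ultimately have "theta_coeff ((q ^ 3) ^ m) (q\<^sup>2) r = q ^ (?e + 2 * r) + q ^ (?e - 2 * r)"
      using False by (simp add: theta_coeff_def distrib_left)
    also have "norm \<dots> \<le> norm q ^ (?e + 2 * r) + norm q ^ (?e - 2 * r)"
      by (rule norm_triangle_le) (simp add: norm_power)
    also have "\<dots> \<le> norm q ^ r + norm q ^ r"
      using assms(1) e by (intro add_mono power_decreasing) auto
    finally show ?thesis
      by simp
  qed (simp add: theta_coeff_def)
qed

theorem theorem1p3:
  fixes \<nu> :: nat and q :: complex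
  assumes "\<nu> \<ge> 1" and "norm q < 1"
  shows "((\<lambda>n. q ^ (3 * (\<Sum>k=1..\<nu>. (tail_sum \<nu> n k)\<^sup>2)) * qpoch (- q) (q ^ 2) (3 * n \<nu>) /
             ((\<Prod>k=1..<\<nu>. qpoch (q ^ 6) (q ^ 6) (n k)) * qpoch (q ^ 6) (q ^ 6) (2 * n \<nu>)))
          has_sum
            (qpoch_inf (- (q ^ 3)) (q ^ 3) / qpoch_inf (q ^ 12) (q ^ 12) *
             qpoch_inf_list [q ^ (6 * (\<nu> + 1)), - (q ^ (3 * \<nu> + 1)), - (q ^ (3 * \<nu> + 5))]
               (q ^ (6 * (\<nu> + 1)))))
          (PiE {1..\<nu>} (\<lambda>_. UNIV :: nat set))"
proof (cases "q = 0")
  \<comment> \<open>The main argument divides by \<open>h\<close> and \<open>z\<close>. At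
    \<open>q = 0\<close> only the zero tuple contributes, and both sides equal 1.\<close>
  case True
  have inf0: "qpoch_inf 0 0 = 1" and fin0: "qpoch 0 0 n = 1" for n
    by (simp_all add: qpoch_inf_def qpoch_def)
  let ?z = "\<lambda>k\<in>{1..\<nu>}. 0 :: nat"
  have tail: "(\<Sum>k=1..\<nu>. (tail_sum \<nu> n k)\<^sup>2) = 0 \<longleftrightarrow> n = ?z" if "n \<in> PiE {1..\<nu>} (\<lambda>_. UNIV)" for n
  proof
    assume "(\<Sum>k=1..\<nu>. (tail_sum \<nu> n k)\<^sup>2) = 0"
    then have "n k = 0" if "k \<in> {1..\<nu>}" for k
      using that by (auto simp: tail_sum_def)
    then show "n = ?z"
      using that by (auto simp: fun_eq_iff PiE_def extensional_def)
  qed (auto simp: tail_sum_def)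
  show ?thesis
    by (rule has_sum_finite_neutralI[of "{?z}"]) (use True assms tail in \<open>auto simp: inf0 fin0 qpoch_inf_list_def tail_sum_def power_0_left\<close>)
next
  case False
  define h where "h = q ^ 3"
  obtain k where \<nu>: "\<nu> = Suc k"
    using assms(1) by (cases \<nu>) auto
  have h1: "norm h < 1" and h0: "h \<noteq> 0"
    using assms(2) False by (simp_all add: h_def norm_power power_less_one_iff)
  have h2: "h\<^sup>2 = q ^ 6"
    by (simp add: h_def flip: power_mult)
  have H1: "norm (h ^ (k + 2)) < 1"
    using power_Suc_less_one[of "norm h" "Suc k"] h0 h1 by (simp add: norm_power norm_mult)
  have b: "qpoch (- h) (h\<^sup>2) n * bailey_sum (h\<^sup>2) (theta_coeff h (q\<^sup>2)) n
      = qpoch (- q) (q\<^sup>2) (3 * n) / qpoch (q ^ 6) (q ^ 6) (2 * n)" for n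
  proof -
    \<comment> \<open>The three residue classes start at \<open>-q\<close>, \<open>-q^3\<close> and
      \<open>-q^5\<close>, which are \<open>-h/z\<close>, \<open>-h\<close> and \<open>-zh\<close>
      for \<open>z = q^2\<close>.\<close>
    have *: "- q * q\<^sup>2 = - h" "- q * (q\<^sup>2)\<^sup>2 = - (q\<^sup>2 * h)" "(q\<^sup>2) ^ 3 = h\<^sup>2" "h / q\<^sup>2 = q"
      using False by (simp_all add: h_def power2_eq_square power3_eq_cube)
    have "q\<^sup>2 \<noteq> 0"
      using False by simp
    then show ?thesis
      unfolding finite_Jacobi_triple[OF h1 h0 \<open>q\<^sup>2 \<noteq> 0\<close>] qpoch_triple * h2[symmetric]
      by (simp only: times_divide_eq_right mult_ac)
  qed
  \<comment> \<open>Jacobi's product with \<open>h^(\<nu>+1) = q^(3\<nu>+3)\<close> in place of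
    \<open>h\<close>: multiplying or dividing by \<open>z = q^2\<close> gives the exponents
    \<open>3\<nu>+5\<close> and \<open>3\<nu>+1\<close>.\<close>
  have "(\<Sum>r. theta_coeff (h ^ (k + 2)) (q\<^sup>2) r)
      = qpoch_inf_list [q ^ (6 * (\<nu> + 1)), - (q ^ (3 * \<nu> + 1)), - (q ^ (3 * \<nu> + 5))] (q ^ (6 * (\<nu> + 1)))"
  proof -
    have "3 * \<nu> + 3 = 3 * (k + 2)"
      by (simp add: \<nu>)
    then have *: "h ^ (k + 2) = q ^ (3 * \<nu> + 3)"
      by (simp only: h_def power_mult)
    have "(h ^ (k + 2))\<^sup>2 = q ^ (6 * (\<nu> + 1))" "q\<^sup>2 * h ^ (k + 2) = q ^ (3 * \<nu> + 5)"
      unfolding * by (simp_all add: algebra_simps flip: power_mult power_add)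
    moreover have "h ^ (k + 2) / q\<^sup>2 = q ^ (3 * \<nu> + 1)"
      using False unfolding * by (simp add: power_add power2_eq_square power3_eq_cube)
    ultimately show ?thesis
      using Jacobi_triple[OF H1, of "q\<^sup>2"] False h0 theta_coeff_summable[OF assms(2) False, of "k + 2"]
      by (simp add: h_def qpoch_inf_list_def mult_ac)
  qed
  moreover have "qpoch_inf (- h) (h\<^sup>2) / qpoch_inf (h\<^sup>2) (h\<^sup>2)
      = qpoch_inf (- (q ^ 3)) (q ^ 3) / qpoch_inf (q ^ 12) (q ^ 12)"
    using qpoch_inf_quotient_even[OF h1] by (simp add: h_def)
  moreover have "multisum_term h (\<lambda>n. qpoch (- q) (q\<^sup>2) (3 * n) / qpoch (q ^ 6) (q ^ 6) (2 * n)) \<nu>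
      = (\<lambda>n. q ^ (3 * (\<Sum>k=1..\<nu>. (tail_sum \<nu> n k)\<^sup>2)) * qpoch (- q) (q ^ 2) (3 * n \<nu>) /
             ((\<Prod>k=1..<\<nu>. qpoch (q ^ 6) (q ^ 6) (n k)) * qpoch (q ^ 6) (q ^ 6) (2 * n \<nu>)))"
    by (simp add: multisum_term_def h2 fun_eq_iff mult.commute) (simp add: h_def power_mult)
  ultimately show ?thesis
    using multisum_theta_has_sum[OF h1 theta_coeff_summable[OF assms(2) False, folded h_def] h0, of k] False
    by (simp add: b \<nu>)
qed

end
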